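(* There exists a planar graph $G$ with $\operatorname{diam}(G)\ge 6$.
   Context: Graphs are finite and simple. For an oriented graph $\overrightarrow{G}$ and $X\subseteq V(\overrightarrow{G})$, the inversion of $X$ reverses every arc having both endpoints in $X$ (and no other arc). For a (labeled) graph $G$, the inversion distance between two orientations of $G$ is the minimum number of inversions transforming one into the other (equality as labeled oriented graphs), and the inversion diameter $\operatorname{diam}(G)$ is the maximum inversion distance over all pairs of orientations of $G$. *)

theory Defs
  imports "HOL-Analysis.Analysis"
begin

definition simple_graph :: "'a set \<Rightarrow> 'a set set \<Rightarrow> bool" where
  "simple_graph V E \<longleftrightarrow> finite V \<and> (\<forall>e\<in>E. e \<subseteq> V \<and> card e = 2)"

text \<open>Planarity is topological: vertices are distinct points of the plane (the type complex),
  each edge is an arc joining its two ends and containing no other vertex, and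
  distinct edges meet only in common ends.\<close>

definition plane_drawing ::
    "'a set \<Rightarrow> 'a set set \<Rightarrow> ('a \<Rightarrow> complex) \<Rightarrow> ('a set \<Rightarrow> real \<Rightarrow> complex) \<Rightarrow> bool" where
  "plane_drawing V E p \<gamma> \<longleftrightarrow>
     inj_on p V \<and>
     (\<forall>e\<in>E. arc (\<gamma> e) \<and> {pathstart (\<gamma> e), pathfinish (\<gamma> e)} = p ` e \<and>
             path_image (\<gamma> e) \<inter> p ` V = p ` e) \<and>
     (\<forall>e\<in>E. \<forall>e'\<in>E. e \<noteq> e' \<longrightarrow> path_image (\<gamma> e) \<inter> path_image (\<gamma> e') = p ` (e \<inter> e'))"

definition planar_graph :: "'a set \<Rightarrow> 'a set set \<Rightarrow> bool" where
  "planar_graph V E \<longleftrightarrow> simple_graph V E \<and> (\<exists>p \<gamma>. plane_drawing V E p \<gamma>)"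

definition orientations :: "'a set set \<Rightarrow> ('a \<times> 'a) set set" where
  "orientations E = {D. (\<forall>(u, v)\<in>D. {u, v} \<in> E) \<and>
                        (\<forall>u v. {u, v} \<in> E \<longrightarrow> ((u, v) \<in> D) \<noteq> ((v, u) \<in> D))}"

definition invert :: "'a set \<Rightarrow> ('a \<times> 'a) set \<Rightarrow> ('a \<times> 'a) set" where
  "invert X D = {(u, v). if u \<in> X \<and> v \<in> X then (v, u) \<in> D else (u, v) \<in> D}"

definition inversion_reachable ::
    "'a set \<Rightarrow> nat \<Rightarrow> ('a \<times> 'a) set \<Rightarrow> ('a \<times> 'a) set \<Rightarrow> bool" where
  "inversion_reachable V k D D' \<longleftrightarrow>
     (\<exists>Xs. length Xs = k \<and> (\<forall>X\<in>set Xs. X \<subseteq> V) \<and> fold invert Xs D = D')"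

definition inversion_distance ::
    "'a set \<Rightarrow> ('a \<times> 'a) set \<Rightarrow> ('a \<times> 'a) set \<Rightarrow> nat" where
  "inversion_distance V D D' = (LEAST k. inversion_reachable V k D D')"

definition inversion_diameter :: "'a set \<Rightarrow> 'a set set \<Rightarrow> nat" where
  "inversion_diameter V E =
     Max {inversion_distance V D D' | D D'. D \<in> orientations E \<and> D' \<in> orientations E}"

text \<open>The minimum and the maximum above are taken over nonempty sets, the latter finite.\<close>

lemma finite_orientations:
  assumes "simple_graph V E"
  shows "finite (orientations E)"
proof (rule finite_subset)
  show "orientations E \<subseteq> Pow (V \<times> V)"
  proof (intro subsetI PowI)
    fix D and x :: "'a \<times> 'a" assume D: "D \<in> orientations E" "x \<in> D"
    obtain u v where x: "x = (u, v)" by (cases x)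
    then have "{u, v} \<in> E" using D unfolding orientations_def by blast
    then have "{u, v} \<subseteq> V" using assms unfolding simple_graph_def by blast
    then show "x \<in> V \<times> V" using x by simp
  qed
  show "finite (Pow (V \<times> V))"
    using assms by (simp add: simple_graph_def)
qed

lemma orientations_nonempty:
  assumes "simple_graph V E"
  shows "orientations E \<noteq> {}"
proof -
  obtain f :: "'a \<Rightarrow> nat" where f: "inj_on f V"
    using assms finite_imp_inj_to_nat_seg unfolding simple_graph_def by metis
  have "{(u, v). {u, v} \<in> E \<and> f u < f v} \<in> orientations E"
  proof -
    have "f u \<noteq> f v" if "{u, v} \<in> E" for u v
    proof -
      have "u \<in> V" "v \<in> V" "card {u, v} = 2"
        using assms that unfolding simple_graph_def by auto
      then show ?thesis using f by (auto simp: inj_on_def)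
    qed
    then show ?thesis
      unfolding orientations_def by (auto simp: insert_commute neq_iff)
  qed
  then show ?thesis by blast
qed

lemma finite_inversion_distances:
  assumes "simple_graph V E"
  shows "finite {inversion_distance V D D' | D D'. D \<in> orientations E \<and> D' \<in> orientations E}"
proof -
  have "{inversion_distance V D D' | D D'. D \<in> orientations E \<and> D' \<in> orientations E}
      = (\<lambda>(D, D'). inversion_distance V D D') ` (orientations E \<times> orientations E)"
    by auto
  then show ?thesis using finite_orientations[OF assms] by simp
qed

lemma fold_invert_edges:
  assumes "distinct es" and "\<forall>e\<in>set es. card e = 2"
    and "\<forall>(a, b)\<in>D. a \<noteq> b"
  shows "fold invert es D = {(u, v). if {u, v} \<in> set es then (v, u) \<in> D else (u, v) \<in> D}"
  using assms
proof (induction es arbitrary: D)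
  case Nil
  then show ?case by auto
next
  case (Cons e es)
  obtain x y where e: "e = {x, y}" "x \<noteq> y"
    using Cons.prems(2) by (auto simp: card_2_iff)
  have inv: "invert e D = {(u, v). if {u, v} = e then (v, u) \<in> D else (u, v) \<in> D}"
    using e Cons.prems(3) unfolding invert_def by (auto simp: doubleton_eq_iff)
  have "\<forall>(a, b)\<in>invert e D. a \<noteq> b"
    using Cons.prems(3) unfolding invert_def by (auto split: if_splits)
  then have "fold invert (e # es) D
      = {(u, v). if {u, v} \<in> set es then (v, u) \<in> invert e D else (u, v) \<in> invert e D}"
    using Cons by simp
  then show ?case
    using Cons.prems(1) unfolding inv by (auto simp: insert_commute)
qed

lemma inversion_reachable_exists:
  assumes G: "simple_graph V E" and D: "D \<in> orientations E" and D': "D' \<in> orientations E"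
  shows "\<exists>k. inversion_reachable V k D D'"
proof -
  have "E \<subseteq> Pow V" "finite (Pow V)"
    using G by (auto simp: simple_graph_def)
  then have "finite E" by (rule finite_subset)
  define F where "F = {e \<in> E. \<exists>u v. e = {u, v} \<and> (u, v) \<in> D \<and> (u, v) \<notin> D'}"
  obtain es where es: "set es = F" "distinct es"
    using finite_distinct_list[of F] \<open>finite E\<close> by (auto simp: F_def)
  have irr: "\<forall>(a, b)\<in>D. a \<noteq> b"
  proof clarify
    fix a assume "(a, a) \<in> D"
    then have "{a, a} \<in> E" using D unfolding orientations_def by blast
    then have "card {a, a} = 2" using G unfolding simple_graph_def by blast
    then show False by simp
  qed
  have "fold invert es D = {(u, v). if {u, v} \<in> F then (v, u) \<in> D else (u, v) \<in> D}"
  proof -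
    have "\<forall>e\<in>set es. card e = 2"
      using es(1) G unfolding F_def simple_graph_def by blast
    then show ?thesis using fold_invert_edges[OF es(2) _ irr] es(1) by simp
  qed
  also have "\<dots> = D'"
  proof -
    have "(if {u, v} \<in> F then (v, u) \<in> D else (u, v) \<in> D) = ((u, v) \<in> D')" for u v
    proof (cases "{u, v} \<in> E")
      case True
      then have "{v, u} \<in> E" by (simp add: insert_commute)
      have o: "((u, v) \<in> D) \<noteq> ((v, u) \<in> D)" "((u, v) \<in> D') \<noteq> ((v, u) \<in> D')"
        using D D' True unfolding orientations_def by auto
      have "{u, v} \<in> F \<longleftrightarrow> (u, v) \<in> D \<and> (u, v) \<notin> D' \<or> (v, u) \<in> D \<and> (v, u) \<notin> D'"
        using True unfolding F_def by (simp add: doubleton_eq_iff) blast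
      then show ?thesis using o by argo
    next
      case False
      then have "{u, v} \<notin> F" "(u, v) \<notin> D" "(u, v) \<notin> D'"
        using D D' unfolding orientations_def F_def by blast+
      then show ?thesis by simp
    qed
    then show ?thesis by auto
  qed
  finally have "fold invert es D = D'" .
  moreover have "\<forall>X\<in>set es. X \<subseteq> V"
    using es(1) \<open>E \<subseteq> Pow V\<close> by (auto simp: F_def)
  ultimately show ?thesis unfolding inversion_reachable_def by blast
qed

end

(*
If the inversion diameter of G is at most 5, then for every 0/1-labelling of the edges there are
vectors in F_2^5 at the vertices whose dot products along the edges are the labels: the i-th
coordinate of the vector at u says whether u lies in the i-th inverted set. So it suffices to
label a planar graph for which no such vectors exist. Planar 3-trees (repeatedly stack a vertex
into a triangular face) suffice. Call a pair of vectors good if it can sit on an edge ab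
whatever labelled stacking is built on ab; several stackings can share the edge ab, so
one finite stacking forces all its edges to be good. A good pair has a good extension for every
labelling of a new stacked vertex, and a few small stackings exclude one type of pair after another
until no good pair is left. The types refer to the splitting F_2^5 = <1> + 1^perp, where 1 is
the all-ones vector, x.x = x.1, and 1^perp is a symplectic space of dimension 4.
*)

theory Submission
  imports Defs
begin

section \<open>Labelled stackings and vectors over the two-element field\<close>

text \<open>An explicit datatype of five bits turns statements about a few vectors into
  propositional formulas in the coordinates, which a SAT solver decides.\<close>

datatype vec = Vec bool bool bool bool bool

instance vec :: finite
proof
  have "(UNIV :: vec set) = (\<lambda>(a, b, c, d, e). Vec a b c d e) ` UNIV"
  proof (intro set_eqI iffI)
    fix x show "x \<in> (\<lambda>(a, b, c, d, e). Vec a b c d e) ` UNIV"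
    proof (cases x)
      case (Vec a b c d e)
      then show ?thesis by (intro image_eqI[where x = "(a, b, c, d, e)"]) auto
    qed
  qed simp
  then show "finite (UNIV :: vec set)"
    by (metis finite finite_imageI)
qed

fun dot :: "vec \<Rightarrow> vec \<Rightarrow> bool" where
  "dot (Vec a1 a2 a3 a4 a5) (Vec b1 b2 b3 b4 b5) \<longleftrightarrow>
     ((a1 \<and> b1) \<noteq> ((a2 \<and> b2) \<noteq> ((a3 \<and> b3) \<noteq> ((a4 \<and> b4) \<noteq> (a5 \<and> b5)))))"

text \<open>Addition of the all-ones vector.\<close>

fun compl_vec :: "vec \<Rightarrow> vec" where
  "compl_vec (Vec a1 a2 a3 a4 a5) = Vec (\<not> a1) (\<not> a2) (\<not> a3) (\<not> a4) (\<not> a5)"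

abbreviation zero_vec :: vec where "zero_vec \<equiv> Vec False False False False False"
abbreviation one_vec :: vec where "one_vec \<equiv> Vec True True True True True"

lemma dot_commute: "dot a b = dot b a"
  by (cases a; cases b) (auto simp: conj_commute)

text \<open>\<open>Node k l m T1 T2 T3\<close> stacks a vertex \<open>d\<close> into the face \<open>abc\<close>, labels the edges \<open>ad\<close>, \<open>bd\<close>,
  \<open>cd\<close> by \<open>k\<close>, \<open>l\<close>, \<open>m\<close> and continues in the faces \<open>abd\<close>, \<open>bcd\<close>, \<open>cad\<close>. The edges of \<open>abc\<close> itself
  are neither present nor labelled.\<close>

datatype stacking = Leaf | Node bool bool bool stacking stacking stacking

fun sat :: "stacking \<Rightarrow> vec \<Rightarrow> vec \<Rightarrow> vec \<Rightarrow> bool" where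
  "sat Leaf a b c \<longleftrightarrow> True"
| "sat (Node k l m T1 T2 T3) a b c \<longleftrightarrow>
     (\<exists>d. dot a d = k \<and> dot b d = l \<and> dot c d = m \<and> sat T1 a b d \<and> sat T2 b c d \<and> sat T3 c a d)"

text \<open>Reflection exchanging \<open>a\<close> and \<open>b\<close>; it makes
  \<open>good\<close> symmetric.\<close>

fun mirror :: "stacking \<Rightarrow> stacking" where
  "mirror Leaf = Leaf"
| "mirror (Node k l m T1 T2 T3) = Node l k m (mirror T1) (mirror T3) (mirror T2)"

lemma sat_mirror: "sat (mirror T) a b c = sat T b a c"
  by (induction T arbitrary: a b c) (simp, auto)

text \<open>\<open>graft T S\<close> builds \<open>S\<close> in the face of \<open>T\<close> at the edge \<open>ab\<close>, which \<open>T\<close> leaves empty.\<close>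

fun graft :: "stacking \<Rightarrow> stacking \<Rightarrow> stacking" where
  "graft Leaf S = S"
| "graft (Node k l m T1 T2 T3) S = Node k l m (graft T1 S) T2 T3"

lemma sat_graft: "sat (graft T S) a b c \<Longrightarrow> sat T a b c \<and> (\<exists>d. sat S a b d)"
  by (induction T arbitrary: c) (simp_all, blast+)

section \<open>Good pairs of vectors\<close>

definition good :: "vec \<Rightarrow> vec \<Rightarrow> bool" where
  "good a b \<longleftrightarrow> (\<forall>T. \<exists>c. sat T a b c)"

lemma good_commute: "good a b \<Longrightarrow> good b a"
  unfolding good_def by (metis sat_mirror)

text \<open>Only finitely many pairs are bad. Each has a stacking that fails for every third corner;
  grafting these along the common edge \<open>ab\<close> rules out all bad pairs at once.\<close>

lemma sat_imp_good: "\<exists>T. \<forall>a b c. sat T a b c \<longrightarrow> good a b"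
proof -
  have "\<exists>T. \<forall>(a, b)\<in>S. \<forall>c. \<not> sat T a b c"
    if "finite S" "\<forall>(a, b)\<in>S. \<not> good a b" for S
    using that
  proof (induction S)
    case (insert x S)
    obtain a b where x: "x = (a, b)" by (cases x)
    obtain T where T: "\<forall>(a, b)\<in>S. \<forall>c. \<not> sat T a b c"
      using insert by auto
    obtain T' where T': "\<forall>c. \<not> sat T' a b c"
      using insert.prems x unfolding good_def by auto
    have "\<forall>(a, b)\<in>insert x S. \<forall>c. \<not> sat (graft T T') a b c"
      using T T' x sat_graft by fastforce
    then show ?case by blast
  qed simp
  from this[of "{(a, b). \<not> good a b}"] show ?thesis by auto
qed

lemma sat_imp_good_edges:
  "\<exists>T. \<forall>a b c. sat T a b c \<longrightarrow> good a b \<and> good b c \<and> good a c"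
proof -
  obtain T where T: "\<forall>a b c. sat T a b c \<longrightarrow> good a b"
    using sat_imp_good by blast
  then have "\<forall>a b c. sat (Node False False False T T T) a b c \<longrightarrow> good a b \<and> good b c \<and> good a c"
    by (auto intro: good_commute)
  then show ?thesis by blast
qed

text \<open>Let \<open>T\<close> force all edges of its face to be good. Stack \<open>c\<close> over
  \<open>ab\<close>, \<open>d\<close> into \<open>abc\<close> and \<open>e\<close> into
  \<open>cad\<close>, and put \<open>T\<close> into the faces \<open>abd\<close>, \<open>bcd\<close>
  and \<open>cae\<close>.\<close>

lemma good_extend:
  assumes "good a b"
  shows "\<exists>c d e. dot a c = ac \<and> dot b c = bc \<and>
    dot a d = ad \<and> dot b d = bd \<and> dot c d = cd \<and>
    dot a e = ae \<and> dot c e = ce \<and> dot d e = de \<and>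
    good a c \<and> good b c \<and> good a d \<and> good b d \<and> good c d"
proof -
  obtain T where T: "\<And>a b c. sat T a b c \<Longrightarrow> good a b \<and> good b c \<and> good a c"
    using sat_imp_good_edges by blast
  \<comment> \<open>\<open>x\<close> is the third corner supplied by \<open>good\<close>; the label
    \<open>False\<close> of \<open>xc\<close> is an arbitrary choice.\<close>
  obtain x where "sat (Node ac bc False (Node ad bd cd T T (Node ce ae de T Leaf Leaf)) Leaf Leaf) a b x"
    using assms unfolding good_def by blast
  then obtain c d e where l: "dot a c = ac" "dot b c = bc" "dot a d = ad" "dot b d = bd"
      "dot c d = cd" "dot a e = ae" "dot c e = ce" "dot d e = de"
    and t: "sat T a b d" "sat T b c d" "sat T c a e"
    by (simp only: sat.simps) blast
  have "good a c" "good b c" "good a d" "good b d" "good c d"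
    using T[OF t(1)] T[OF t(2)] T[OF t(3)] good_commute by simp_all
  with l show ?thesis by (intro exI[of _ c] exI[of _ d] exI[of _ e] conjI)
qed

lemma good_extend_one:
  assumes "good a b"
  shows "\<exists>c. dot a c = ac \<and> dot b c = bc \<and> good a c \<and> good b c"
  using good_extend[OF assms, of ac bc False False False False False False] by (elim exE conjE) (intro exI conjI)

text \<open>A further vertex may have any two labels towards \<open>a\<close> and \<open>b\<close>,
  so these vectors are linearly independent.\<close>

lemma good_distinct:
  assumes "good a b"
  shows "a \<noteq> zero_vec" "b \<noteq> zero_vec" "a \<noteq> b"
proof -
  obtain c where c: "dot a c" "\<not> dot b c"
    using good_extend_one[OF assms, of True False] by (simp only: eq_True eq_False) blast
  obtain d where "dot b d"
    using good_extend_one[OF assms, of True True] by (simp only: eq_True eq_False) blast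
  then show "a \<noteq> zero_vec" "b \<noteq> zero_vec" "a \<noteq> b"
    using c by (cases c; cases d; auto)+
qed

section \<open>Types of good pairs excluded in turn\<close>

text \<open>Otherwise \<open>a\<close>, \<open>c\<close>, \<open>d\<close> below are mutually orthogonal in the symplectic space \<open>1\<^sup>\<bottom>\<close> of dimension 4,
  which forces \<open>d = a + c\<close>; the labels of \<open>e\<close> exclude this.\<close>

lemma good_orthogonal_not_one:
  assumes g: "good a b" and n: "\<not> dot a a" "\<not> dot a b"
  shows "b \<noteq> one_vec" "b \<noteq> compl_vec a"
proof -
  \<comment> \<open>If \<open>b\<close> is \<open>1\<close> or \<open>1 + a\<close>, then
    \<open>c\<close> and \<open>d\<close>, being orthogonal to \<open>a\<close> and
    \<open>b\<close>, are orthogonal to \<open>1\<close> and hence isotropic.\<close>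
  obtain c d e where *: "\<not> dot a c" "\<not> dot b c" "\<not> dot a d" "\<not> dot b d" "\<not> dot c d"
    "\<not> dot a e" "\<not> dot c e" "dot d e" "good a c" "good b c" "good a d" "good b d" "good c d"
    using good_extend[OF g, of False False False False False False False True] by (simp only: eq_True eq_False) blast
  note nz = good_distinct[OF g] good_distinct[OF *(9)] good_distinct[OF *(11)] good_distinct[OF *(13)]
  show "b \<noteq> one_vec" "b \<noteq> compl_vec a"
    using n *(1-8) nz
    by (cases a; cases b; cases c; cases d; cases e;
        simp only: dot.simps compl_vec.simps vec.inject; sat)+
qed

text \<open>A vector \<open>c\<close> orthogonal to \<open>a\<close> and to the all-ones vector is
  isotropic, so \<open>good_orthogonal_not_one\<close> forbids the pair of \<open>c\<close> and the
  all-ones vector.\<close>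

lemma good_not_one:
  assumes "good a b"
  shows "b \<noteq> one_vec"
proof
  assume b: "b = one_vec"
  obtain c where c: "\<not> dot a c" "\<not> dot b c" "good b c"
    using good_extend_one[OF assms, of False False] by (simp only: eq_True eq_False) blast
  then have "\<not> dot c c" using b by (cases c) auto
  then show False
    using good_orthogonal_not_one(1)[of c b] c b by (metis good_commute dot_commute)
qed

text \<open>Otherwise \<open>c\<close> and \<open>d\<close> below lie in \<open>{a, b}\<^sup>\<bottom> = \<langle>a, b, 1\<rangle>\<close>, and the previous lemmas leave
  \<open>{c, d} = {a + b, a + b + 1}\<close>, so that \<open>c + d = 1\<close>.\<close>

lemma good_isotropic_not_orthogonal:
  assumes g: "good a b" and n: "\<not> dot a a" "\<not> dot b b"
  shows "dot a b"
proof (rule ccontr)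
  assume ab: "\<not> dot a b"
  obtain c d where *: "\<not> dot a c" "\<not> dot b c" "\<not> dot a d" "\<not> dot b d" "\<not> dot c d"
     "good a c" "good b c" "good a d" "good b d" "good c d"
    using good_extend[OF g, of False False False False False False False False] by (simp only: eq_True eq_False) blast
  note nz = good_distinct[OF g] good_distinct[OF *(6)] good_distinct[OF *(8)] good_distinct[OF *(10)]
    good_distinct[OF *(7)] good_distinct[OF *(9)]
  note no = good_orthogonal_not_one[OF *(6) n(1) *(1)] good_orthogonal_not_one[OF *(8) n(1) *(3)]
    good_orthogonal_not_one[OF *(7) n(2) *(2)] good_orthogonal_not_one[OF *(9) n(2) *(4)]
  have no': "\<not> dot c c \<Longrightarrow> d \<noteq> compl_vec c" "\<not> dot d d \<Longrightarrow> c \<noteq> compl_vec d"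
    using good_orthogonal_not_one * good_commute dot_commute by blast+
  show False
    using n ab *(1-5) nz no no'
    by (cases a; cases b; cases c; cases d;
        simp only: dot.simps compl_vec.simps vec.inject; sat)
qed

text \<open>If \<open>a \<cdot> a = 0\<close>, then every \<open>x\<close> with \<open>good a x\<close> and \<open>a \<cdot> x = 0\<close> has \<open>x \<cdot> x = 1\<close>. After projecting to
  \<open>1\<^sup>\<bottom>\<close>, the vectors \<open>a\<close> and \<open>b\<close> (if \<open>a \<cdot> b = 1\<close>) or \<open>b\<close> and \<open>c\<close> (if \<open>a \<cdot> b = 0\<close>) span a hyperbolic
  plane, and the remaining two vectors lie, modulo \<open>a\<close>, in its orthogonal complement, a plane.\<close>

lemma good_nonisotropic:
  assumes g: "good a b"
  shows "dot a a"
proof (rule ccontr)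
  assume a: "\<not> dot a a"
  have norm1: "dot x x" if "good a x" "\<not> dot a x" for x
    using good_isotropic_not_orthogonal[OF that(1) a] that(2) by blast
  show False
  proof (cases "dot a b")
    case True
    obtain c d where *: "\<not> dot a c" "\<not> dot b c" "\<not> dot a d" "\<not> dot b d" "dot c d"
     "good a c" "good b c" "good a d" "good b d" "good c d"
      using good_extend[OF g, of False False False False True False False False] by (simp only: eq_True eq_False) blast
    \<comment> \<open>Modulo \<open>a\<close>, the projections of \<open>c\<close> and
      \<open>d\<close> are orthogonal vectors of a plane. Either one vanishes, making
      \<open>c\<close> or \<open>d\<close> equal to \<open>1\<close> or \<open>1 + a\<close>, or
      they agree, and then \<open>c = d\<close> because \<open>b\<close> pairs equally with
      both.\<close>
    have "dot c c" "dot d d" using norm1 * by blast+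
    moreover note good_distinct[OF *(10)] good_not_one[OF *(6)] good_not_one[OF *(8)]
     good_orthogonal_not_one[OF *(6) a *(1)] good_orthogonal_not_one[OF *(8) a *(3)]
    ultimately show ?thesis using True a *(1-5)
    by (cases a; cases b; cases c; cases d;
        simp only: dot.simps compl_vec.simps vec.inject; sat)
  next
    case False
    obtain c d where *: "\<not> dot a c" "\<not> dot b c" "\<not> dot a d" "dot b d" "dot c d"
     "good a c" "good b c" "good a d" "good b d" "good c d"
      using good_extend[OF g, of False False False True True False False False] by (simp only: eq_True eq_False) blast
    \<comment> \<open>Here the nonzero \<open>a\<close> and the projection of \<open>d\<close> are
      orthogonal in a plane, so \<open>d\<close> is \<open>1\<close> or
      \<open>1 + a\<close>.\<close>
    have "dot b b" "dot c c" "dot d d" using norm1 * g False by blast+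
    moreover note good_distinct[OF g] good_orthogonal_not_one[OF *(8) a *(3)]
    ultimately show ?thesis using False a *(1-5)
    by (cases a; cases b; cases c; cases d;
        simp only: dot.simps compl_vec.simps vec.inject; sat)
  qed
qed

text \<open>All vectors now have the form \<open>1 + s\<close> with \<open>s \<in> 1\<^sup>\<bottom>\<close>. As \<open>a \<cdot> b' = 1\<close>, the \<open>s\<close>-parts of \<open>a\<close> and \<open>b'\<close> span a
  Lagrangian plane, which contains that of \<open>d\<close>; only \<open>d = a\<close> and \<open>d = b'\<close> agree with the labels.\<close>

lemma not_good: "\<not> good a b"
proof
  assume "good a b"
  then obtain b' where b': "dot a b'" "good a b'"
    using good_extend_one[of a b True True] by (simp only: eq_True eq_False) blast
  \<comment> \<open>The \<open>s\<close>-part of \<open>c\<close> pairs to 1 with those of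
    \<open>a\<close>, \<open>b'\<close> and \<open>d\<close>; hence the \<open>s\<close>-part of
    \<open>d\<close> is neither 0 nor the sum of the other two.\<close>
  obtain c d where *: "\<not> dot a c" "\<not> dot b' c" "dot a d" "dot b' d" "\<not> dot c d"
     "good a c" "good b' c" "good a d" "good b' d" "good c d"
    using good_extend[OF b'(2), of False False True True False False False False] by (simp only: eq_True eq_False) blast
  have "dot a a" "dot b' b'" "dot c c" "dot d d"
    using good_nonisotropic good_commute b' * by blast+
  then show False
    using good_distinct[OF b'(2)] good_distinct[OF *(8)] good_distinct[OF *(9)] b'(1) *(1-5)
    by (cases a; cases b'; cases c; cases d;
        simp only: dot.simps vec.inject; sat)
qed

lemma unsatisfiable_stacking: "\<exists>T. \<forall>a b c. \<not> sat T a b c"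
  using sat_imp_good not_good by blast

section \<open>Inversions and dot products\<close>

text \<open>Peels off one set as an exclusive or, the shape in which \<open>dot\<close> is
  defined.\<close>

lemma odd_length_filter_Cons:
  "odd (length (filter P (x # xs))) = (P x \<noteq> odd (length (filter P xs)))"
  by simp

lemma fold_invert:
  "fold invert Xs D =
     {(u, v). if odd (length (filter (\<lambda>X. u \<in> X \<and> v \<in> X) Xs)) then (v, u) \<in> D else (u, v) \<in> D}"
proof (induction Xs arbitrary: D)
  case (Cons X Xs)
  show ?case unfolding fold.simps o_def Cons.IH by (auto simp: invert_def conj_commute)
qed simp

lemma inversion_distance_le_diameter:
  assumes "simple_graph V E" "D \<in> orientations E" "D' \<in> orientations E"
  shows "inversion_distance V D D' \<le> inversion_diameter V E"
  unfolding inversion_diameter_def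
  using finite_inversion_distances[OF assms(1)] assms(2,3) by (intro Max_ge) auto

text \<open>Apply the bound to two orientations differing exactly on \<open>F\<close>: an edge lies
  in \<open>F\<close> iff an odd number of the inverted sets contain both ends, and this parity is
  the dot product.\<close>

lemma vectors_of_inversion_diameter:
  assumes G: "simple_graph V E" and diam: "inversion_diameter V E \<le> 5"
  shows "\<exists>f. \<forall>u v. {u, v} \<in> E \<longrightarrow> dot (f u) (f v) = ({u, v} \<in> F)"
proof -
  obtain D where D: "D \<in> orientations E" using orientations_nonempty[OF G] by blast
  define D' where "D' = {(u, v). if {u, v} \<in> F then (v, u) \<in> D else (u, v) \<in> D}"
  have D': "D' \<in> orientations E"
  proof -
    have mem: "(u, v) \<in> D' \<longleftrightarrow> (if {u, v} \<in> F then (v, u) \<in> D else (u, v) \<in> D)" for u v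
      by (simp add: D'_def)
    have "{u, v} \<in> E" if "(u, v) \<in> D'" for u v
    proof -
      have "(u, v) \<in> D \<or> (v, u) \<in> D" using that unfolding mem by argo
      then have "{u, v} \<in> E \<or> {v, u} \<in> E" using D unfolding orientations_def by blast
      then show ?thesis by (simp only: insert_commute[of v u] disj_absorb)
    qed
    moreover have "((u, v) \<in> D') \<noteq> ((v, u) \<in> D')" if "{u, v} \<in> E" for u v
    proof -
      have "((u, v) \<in> D) \<noteq> ((v, u) \<in> D)" using D that unfolding orientations_def by blast
      then show ?thesis unfolding mem insert_commute[of v u] by argo
    qed
    ultimately show ?thesis unfolding orientations_def by blast
  qed
  define k where "k = inversion_distance V D D'"
  have "inversion_reachable V k D D'"
    unfolding k_def inversion_distance_def
    using inversion_reachable_exists[OF G D D'] by (rule LeastI_ex)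
  then obtain Xs where Xs: "length Xs = k" "fold invert Xs D = D'"
    unfolding inversion_reachable_def by blast
  have "k \<le> 5" using inversion_distance_le_diameter[OF G D D'] diam k_def by simp
  \<comment> \<open>Padding with empty sets, whose inversion changes nothing, gives exactly five
    coordinates.\<close>
  define Ys where "Ys = Xs @ replicate (5 - k) {}"
  have "length Ys = 5" using Xs(1) \<open>k \<le> 5\<close> by (simp add: Ys_def)
  then obtain X1 X2 X3 X4 X5 where Ys: "Ys = [X1, X2, X3, X4, X5]"
    by (auto simp: length_Suc_conv eval_nat_numeral)
  define f where "f u = Vec (u \<in> X1) (u \<in> X2) (u \<in> X3) (u \<in> X4) (u \<in> X5)" for u
  have dot: "dot (f u) (f v) = odd (length (filter (\<lambda>X. u \<in> X \<and> v \<in> X) Xs))" for u v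
  proof -
    have "filter (\<lambda>X. u \<in> X \<and> v \<in> X) Ys = filter (\<lambda>X. u \<in> X \<and> v \<in> X) Xs"
      by (simp add: Ys_def filter_replicate)
    moreover have "dot (f u) (f v) = odd (length (filter (\<lambda>X. u \<in> X \<and> v \<in> X) Ys))"
      by (simp only: Ys f_def dot.simps odd_length_filter_Cons) simp
    ultimately show ?thesis by simp
  qed
  have "dot (f u) (f v) = ({u, v} \<in> F)" if "{u, v} \<in> E" for u v
  proof -
    have "((u, v) \<in> D) \<noteq> ((v, u) \<in> D)" using D that unfolding orientations_def by blast
    moreover have "(u, v) \<in> fold invert Xs D \<longleftrightarrow> (u, v) \<in> D'" using Xs(2) by simp
    ultimately show ?thesis
      unfolding fold_invert dot D'_def mem_Collect_eq prod.case by argo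
  qed
  then show ?thesis by blast
qed
section \<open>Straight-line drawings of stackings\<close>

text \<open>Convex hulls of unordered pairs spare the choice of a direction for each edge, and the
  hypotheses keep only the nontrivial inclusions of \<open>plane_drawing\<close>.\<close>

lemma planar_graph_straight_line:
  fixes p :: "'a \<Rightarrow> complex"
  assumes fin: "finite V" and E: "\<forall>e\<in>E. e \<subseteq> V \<and> card e = 2" and inj: "inj_on p V"
    and vert: "\<forall>e\<in>E. convex hull (p ` e) \<inter> p ` V \<subseteq> p ` e"
    and cross: "\<forall>e\<in>E. \<forall>e'\<in>E. e \<noteq> e' \<longrightarrow> convex hull (p ` e) \<inter> convex hull (p ` e') \<subseteq> p ` (e \<inter> e')"
  shows "planar_graph V E"
proof -
  have "\<exists>x y. e = {x, y} \<and> x \<noteq> y" if "e \<in> E" for e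
    using E that by (auto simp: card_2_iff)
  then obtain s t where st: "\<And>e. e \<in> E \<Longrightarrow> e = {s e, t e} \<and> s e \<noteq> t e" by metis
  define \<gamma> where "\<gamma> e = linepath (p (s e)) (p (t e))" for e
  have pe: "p ` e = {p (s e), p (t e)}" if "e \<in> E" for e
    by (subst conjunct1[OF st[OF that]]) simp
  have hull: "path_image (\<gamma> e) = convex hull (p ` e)" if "e \<in> E" for e
    unfolding pe[OF that] \<gamma>_def by (simp add: segment_convex_hull)
  have arc: "arc (\<gamma> e)" if "e \<in> E" for e
  proof -
    have "s e \<in> V" "t e \<in> V" "s e \<noteq> t e" using E st[OF that] that by blast+
    then show ?thesis using inj unfolding \<gamma>_def by (intro arc_linepath) (auto dest: inj_onD)
  qed
  have "plane_drawing V E p \<gamma>"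
    unfolding plane_drawing_def
  proof (intro conjI ballI impI inj)
    fix e assume e: "e \<in> E"
    show "arc (\<gamma> e)" using arc e .
    show "{pathstart (\<gamma> e), pathfinish (\<gamma> e)} = p ` e" using pe[OF e] by (simp add: \<gamma>_def)
    show "path_image (\<gamma> e) \<inter> p ` V = p ` e"
      using vert E e hull_subset[of "p ` e" convex] unfolding hull[OF e] by blast
  next
    fix e e' assume e: "e \<in> E" "e' \<in> E" "e \<noteq> e'"
    show "path_image (\<gamma> e) \<inter> path_image (\<gamma> e') = p ` (e \<inter> e')"
      unfolding hull[OF e(1)] hull[OF e(2)]
    proof (rule equalityI)
      show "convex hull (p ` e) \<inter> convex hull (p ` e') \<subseteq> p ` (e \<inter> e')" using cross e by simp
      show "p ` (e \<inter> e') \<subseteq> convex hull (p ` e) \<inter> convex hull (p ` e')"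
        by (intro Int_greatest order_trans[OF image_mono hull_subset]) simp_all
    qed
  qed
  then show ?thesis using fin E unfolding planar_graph_def simple_graph_def by blast
qed

section \<open>Barycentric coordinates in a triangle\<close>

definition bary :: "complex \<Rightarrow> complex \<Rightarrow> complex \<Rightarrow> real \<Rightarrow> real \<Rightarrow> real \<Rightarrow> complex" where
  "bary A B C x y z = x *\<^sub>R A + y *\<^sub>R B + z *\<^sub>R C"

text \<open>Affine independence of the three points.\<close>

definition nondegenerate :: "complex \<Rightarrow> complex \<Rightarrow> complex \<Rightarrow> bool" where
  "nondegenerate A B C \<longleftrightarrow>
     (\<forall>x y z. x + y + z = 0 \<longrightarrow> bary A B C x y z = 0 \<longrightarrow> x = 0 \<and> y = 0 \<and> z = 0)"

definition centroid :: "complex \<Rightarrow> complex \<Rightarrow> complex \<Rightarrow> complex" where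
  "centroid A B C = bary A B C (1/3) (1/3) (1/3)"

text \<open>The open triangle with its corners. The sides are left out, since a stacking does not
  draw them; thus neighbouring faces share only corners.\<close>

definition region :: "complex \<Rightarrow> complex \<Rightarrow> complex \<Rightarrow> complex set" where
  "region A B C = {A, B, C} \<union> {bary A B C x y z | x y z. x + y + z = 1 \<and> 0 < x \<and> 0 < y \<and> 0 < z}"

lemma bary_unique:
  assumes "nondegenerate A B C" "x + y + z = 1" "x' + y' + z' = 1"
    and "bary A B C x y z = bary A B C x' y' z'"
  shows "x = x' \<and> y = y' \<and> z = z'"
proof -
  have "bary A B C (x - x') (y - y') (z - z') = 0"
    using assms(4) by (simp add: bary_def algebra_simps)
  moreover have "(x - x') + (y - y') + (z - z') = 0" using assms(2,3) by simp
  ultimately have "x - x' = 0 \<and> y - y' = 0 \<and> z - z' = 0"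
    using assms(1) unfolding nondegenerate_def by blast
  then show ?thesis by simp
qed

lemma bary_rotate: "bary B C A y z x = bary A B C x y z"
  by (simp add: bary_def)

lemma bary_swap: "bary A C B x z y = bary A B C x y z"
  by (simp add: bary_def)

lemma bary_centroid:
  "bary A B (centroid A B C) x y z = bary A B C (x + z/3) (y + z/3) (z/3)"
  by (simp add: bary_def centroid_def algebra_simps)

lemma bary_corner: "bary A B C 1 0 0 = A" "bary A B C 0 1 0 = B" "bary A B C 0 0 1 = C"
  by (simp_all add: bary_def)

lemma centroid_rotate: "centroid B C A = centroid A B C"
  by (simp add: centroid_def bary_rotate)

lemma region_rotate: "region B C A = region A B C"
proof -
  have "region A B C \<subseteq> region B C A" for A B C
  proof
    fix P assume "P \<in> region A B C"
    then consider "P \<in> {A, B, C}"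
      | x y z where "P = bary A B C x y z" "x + y + z = 1" "0 < x" "0 < y" "0 < z"
      unfolding region_def by blast
    then show "P \<in> region B C A"
    proof cases
      case 2
      then have "P = bary B C A y z x" "y + z + x = 1" by (simp_all add: bary_rotate)
      with 2 show ?thesis unfolding region_def by blast
    qed (auto simp: region_def)
  qed
  then show ?thesis by blast
qed

lemma region_swap: "region A C B = region A B C"
proof -
  have "region A B C \<subseteq> region A C B" for A B C
  proof
    fix P assume "P \<in> region A B C"
    then consider "P \<in> {A, B, C}"
      | x y z where "P = bary A B C x y z" "x + y + z = 1" "0 < x" "0 < y" "0 < z"
      unfolding region_def by blast
    then show "P \<in> region A C B"
    proof cases
      case 2
      then have "P = bary A C B x z y" "x + z + y = 1" by (simp_all add: bary_swap)
      with 2 show ?thesis unfolding region_def by blast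
    qed (auto simp: region_def)
  qed
  then show ?thesis by blast
qed

lemma region_flip: "region A B C = region B A C"
  using region_rotate[of B A C] region_swap[of A C B] region_rotate[of A C B] by simp

lemma nondegenerate_rotate:
  assumes "nondegenerate A B C"
  shows "nondegenerate B C A"
  unfolding nondegenerate_def
proof (intro allI impI)
  fix x y z :: real
  assume "x + y + z = 0" "bary B C A x y z = 0"
  then have "z + x + y = 0" "bary A B C z x y = 0"
    using bary_rotate[of B C A] by simp_all
  then show "x = 0 \<and> y = 0 \<and> z = 0" using assms unfolding nondegenerate_def by blast
qed

lemma nondegenerate_swap:
  assumes "nondegenerate A B C"
  shows "nondegenerate A C B"
  unfolding nondegenerate_def
proof (intro allI impI)
  fix x y z :: real
  assume "x + y + z = 0" "bary A C B x y z = 0"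
  then have "x + z + y = 0" "bary A B C x z y = 0"
    using bary_swap[of A C B] by simp_all
  then show "x = 0 \<and> y = 0 \<and> z = 0" using assms unfolding nondegenerate_def by blast
qed

lemma nondegenerate_centroid:
  assumes "nondegenerate A B C"
  shows "nondegenerate A B (centroid A B C)"
  unfolding nondegenerate_def
proof (intro allI impI)
  fix x y z :: real
  assume "x + y + z = 0" "bary A B (centroid A B C) x y z = 0"
  then have "(x + z/3) + (y + z/3) + z/3 = 0" "bary A B C (x + z/3) (y + z/3) (z/3) = 0"
    unfolding bary_centroid by simp_all
  then have "x + z/3 = 0 \<and> y + z/3 = 0 \<and> z/3 = 0"
    using assms unfolding nondegenerate_def by blast
  then show "x = 0 \<and> y = 0 \<and> z = 0" by simp
qed

lemma nondegenerate_corners: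
  assumes "nondegenerate A B C"
  shows "A \<noteq> B" "B \<noteq> C" "A \<noteq> C"
  using bary_unique[OF assms, of 1 0 0 0 1 0] bary_unique[OF assms, of 0 1 0 0 0 1]
    bary_unique[OF assms, of 1 0 0 0 0 1]
  by (auto simp: bary_corner)

text \<open>The open face at \<open>AB\<close> is where the coordinate at \<open>C\<close> is
  positive and strictly the smallest. This reduces all intersections of faces and spokes to
  comparing coordinates.\<close>

lemma subregion_coordinates:
  assumes "P \<in> region A B (centroid A B C)"
  obtains x y z where "P = bary A B C x y z" "x + y + z = 1"
    "0 < z \<and> z < x \<and> z < y \<or> x = 1 \<and> y = 0 \<and> z = 0 \<or> x = 0 \<and> y = 1 \<and> z = 0 \<or> x = 1/3 \<and> y = 1/3 \<and> z = 1/3"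
proof -
  consider "P = A" | "P = B" | "P = centroid A B C"
    | x y z where "P = bary A B (centroid A B C) x y z" "x + y + z = 1" "0 < x" "0 < y" "0 < z"
    using assms unfolding region_def by blast
  then show ?thesis
  proof cases
    case 1 then show ?thesis using that[of 1 0 0] by (simp add: bary_corner)
  next
    case 2 then show ?thesis using that[of 0 1 0] by (simp add: bary_corner)
  next
    case 3 then show ?thesis using that[of "1/3" "1/3" "1/3"] by (simp add: centroid_def)
  next
    case 4 then show ?thesis
      using that[of "x + z/3" "y + z/3" "z/3"] by (simp add: bary_centroid)
  qed
qed

lemma spoke_coordinates:
  assumes "P \<in> closed_segment A (centroid A B C)"
  obtains x y where "P = bary A B C x y y" "x + y + y = 1" "0 \<le> y" "y \<le> x"
proof -
  obtain u where u: "P = (1 - u) *\<^sub>R A + u *\<^sub>R centroid A B C" "0 \<le> u" "u \<le> 1"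
    using assms by (auto simp: in_segment)
  moreover have "(1 - u + u/3) *\<^sub>R A = (1 - u) *\<^sub>R A + (u/3) *\<^sub>R A"
    by (rule scaleR_left_distrib)
  ultimately have "P = bary A B C (1 - u + u/3) (u/3) (u/3)"
    by (simp add: centroid_def bary_def scaleR_add_right)
  then show ?thesis using that u by simp
qed

lemma spokes_meet:
  assumes "nondegenerate A B C"
  shows "closed_segment A (centroid A B C) \<inter> closed_segment B (centroid A B C) \<subseteq> {centroid A B C}"
proof
  fix P assume P: "P \<in> closed_segment A (centroid A B C) \<inter> closed_segment B (centroid A B C)"
  obtain x y where xy: "P = bary A B C x y y" "x + y + y = 1" "0 \<le> y" "y \<le> x"
    using P spoke_coordinates by blast
  obtain x' y' where xy': "P = bary B C A x' y' y'" "x' + y' + y' = 1" "0 \<le> y'" "y' \<le> x'"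
    using P spoke_coordinates centroid_rotate by (metis IntD2)
  have "x = y' \<and> y = x' \<and> y = y'"
    using bary_unique[OF assms] xy xy' bary_rotate[of B C A] by (metis add.commute)
  then have "x = 1/3 \<and> y = 1/3" using xy(2) by auto
  then show "P \<in> {centroid A B C}" using xy(1) by (simp only: centroid_def singleton_iff)
qed

text \<open>On the spoke the coordinates at \<open>B\<close> and \<open>C\<close> agree, while
  inside the adjacent face the one at \<open>C\<close> is strictly smaller.\<close>

lemma spoke_meets_adjacent_region:
  assumes "nondegenerate A B C"
  shows "closed_segment A (centroid A B C) \<inter> region A B (centroid A B C) \<subseteq> {A, centroid A B C}"
proof
  fix P assume P: "P \<in> closed_segment A (centroid A B C) \<inter> region A B (centroid A B C)"
  obtain x y where xy: "P = bary A B C x y y" "x + y + y = 1" "0 \<le> y" "y \<le> x"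
    using P spoke_coordinates by blast
  obtain x' y' z' where xy': "P = bary A B C x' y' z'" "x' + y' + z' = 1"
    "0 < z' \<and> z' < x' \<and> z' < y' \<or> x' = 1 \<and> y' = 0 \<and> z' = 0 \<or> x' = 0 \<and> y' = 1 \<and> z' = 0 \<or>
     x' = 1/3 \<and> y' = 1/3 \<and> z' = 1/3"
    using P subregion_coordinates by blast
  have "x = x' \<and> y = y' \<and> y = z'"
    using bary_unique[OF assms xy(2) xy'(2)] xy(1) xy'(1) by simp
  then have "x = 1 \<and> y = 0 \<or> x = 1/3 \<and> y = 1/3" using xy'(3) by auto
  then show "P \<in> {A, centroid A B C}" using xy(1)
    by (elim disjE) (simp_all only: centroid_def bary_corner insert_iff simp_thms)
qed

text \<open>The coordinate at \<open>A\<close> is a largest one on the spoke, but strictly the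
  smallest inside the opposite face.\<close>

lemma spoke_meets_opposite_region:
  assumes "nondegenerate A B C"
  shows "closed_segment A (centroid A B C) \<inter> region B C (centroid A B C) \<subseteq> {centroid A B C}"
proof
  fix P assume P: "P \<in> closed_segment A (centroid A B C) \<inter> region B C (centroid A B C)"
  obtain x y where xy: "P = bary A B C x y y" "x + y + y = 1" "0 \<le> y" "y \<le> x"
    using P spoke_coordinates by blast
  have "P \<in> region B C (centroid B C A)" using P by (simp add: centroid_rotate)
  then obtain x' y' z' where xy': "P = bary B C A x' y' z'" "x' + y' + z' = 1"
    "0 < z' \<and> z' < x' \<and> z' < y' \<or> x' = 1 \<and> y' = 0 \<and> z' = 0 \<or> x' = 0 \<and> y' = 1 \<and> z' = 0 \<or>
     x' = 1/3 \<and> y' = 1/3 \<and> z' = 1/3"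
    by (rule subregion_coordinates)
  have "z' + x' + y' = 1" using xy'(2) by simp
  then have "x = z' \<and> y = x' \<and> y = y'"
    using bary_unique[OF assms xy(2)] xy(1) xy'(1) bary_rotate[of B C A] by metis
  then have "x = 1/3 \<and> y = 1/3" using xy'(3) xy by auto
  then show "P \<in> {centroid A B C}" using xy(1) by (simp only: centroid_def singleton_iff)
qed

lemma subregions_meet:
  assumes "nondegenerate A B C"
  shows "region A B (centroid A B C) \<inter> region B C (centroid A B C) \<subseteq> {B, centroid A B C}"
proof
  fix P assume P: "P \<in> region A B (centroid A B C) \<inter> region B C (centroid A B C)"
  then obtain x y z where xy: "P = bary A B C x y z" "x + y + z = 1"
    "0 < z \<and> z < x \<and> z < y \<or> x = 1 \<and> y = 0 \<and> z = 0 \<or> x = 0 \<and> y = 1 \<and> z = 0 \<or>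
     x = 1/3 \<and> y = 1/3 \<and> z = 1/3"
    using subregion_coordinates by blast
  have "P \<in> region B C (centroid B C A)" using P by (simp add: centroid_rotate)
  then obtain x' y' z' where xy': "P = bary B C A x' y' z'" "x' + y' + z' = 1"
    "0 < z' \<and> z' < x' \<and> z' < y' \<or> x' = 1 \<and> y' = 0 \<and> z' = 0 \<or> x' = 0 \<and> y' = 1 \<and> z' = 0 \<or>
     x' = 1/3 \<and> y' = 1/3 \<and> z' = 1/3"
    by (rule subregion_coordinates)
  have "z' + x' + y' = 1" using xy'(2) by simp
  then have "x = z' \<and> y = x' \<and> z = y'"
    using bary_unique[OF assms xy(2)] xy(1) xy'(1) bary_rotate[of B C A] by metis
  then have "x = 0 \<and> y = 1 \<and> z = 0 \<or> x = 1/3 \<and> y = 1/3 \<and> z = 1/3" using xy(3) xy'(3) by auto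
  then show "P \<in> {B, centroid A B C}" using xy(1)
    by (elim disjE) (simp_all only: centroid_def bary_corner insert_iff simp_thms)
qed

lemma subregion_subset: "region A B (centroid A B C) \<subseteq> region A B C"
proof
  fix P assume "P \<in> region A B (centroid A B C)"
  then obtain x y z where xy: "P = bary A B C x y z" "x + y + z = 1"
    "0 < z \<and> z < x \<and> z < y \<or> x = 1 \<and> y = 0 \<and> z = 0 \<or> x = 0 \<and> y = 1 \<and> z = 0 \<or>
     x = 1/3 \<and> y = 1/3 \<and> z = 1/3"
    by (rule subregion_coordinates)
  then have "0 < x \<and> 0 < y \<and> 0 < z \<or> P = A \<or> P = B" by (auto simp: bary_corner)
  then show "P \<in> region A B C" using xy unfolding region_def by blast
qed

lemma spoke_subset: "closed_segment A (centroid A B C) \<subseteq> region A B C"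
proof
  fix P assume "P \<in> closed_segment A (centroid A B C)"
  then obtain x y where xy: "P = bary A B C x y y" "x + y + y = 1" "0 \<le> y" "y \<le> x"
    by (rule spoke_coordinates)
  show "P \<in> region A B C"
  proof (cases "y = 0")
    case True
    then show ?thesis using xy by (auto simp: region_def bary_corner)
  next
    case False
    then have "0 < x" "0 < y" using xy by auto
    then show ?thesis using xy unfolding region_def by blast
  qed
qed

section \<open>Gluing straight-line drawings\<close>

text \<open>\<open>N\<close> is a straight-line drawing within \<open>S\<close>, with vertices taken as points of the plane; \<open>K\<close> is
  the set of points at which it may touch other drawings, so an edge may contain a point of \<open>K\<close>
  only as an end.\<close>

definition drawn_in :: "(complex set \<times> bool) set \<Rightarrow> complex set \<Rightarrow> complex set \<Rightarrow> bool" where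
  "drawn_in N S K \<longleftrightarrow> finite K \<and> K \<subseteq> S \<and>
     (\<forall>e l. (e, l) \<in> N \<longrightarrow> card e = 2 \<and> convex hull e \<subseteq> S \<and> convex hull e \<inter> K \<subseteq> e) \<and>
     (\<forall>e l e' l'. (e, l) \<in> N \<longrightarrow> (e', l') \<in> N \<longrightarrow> (e, l) \<noteq> (e', l') \<longrightarrow>
        e \<noteq> e' \<and> convex hull e \<inter> convex hull e' \<subseteq> e \<inter> e')"

lemma drawn_inI:
  assumes "finite K" "K \<subseteq> S"
    and "\<And>e l. (e, l) \<in> N \<Longrightarrow> card e = 2 \<and> convex hull e \<subseteq> S \<and> convex hull e \<inter> K \<subseteq> e"
    and "\<And>e l e' l'. (e, l) \<in> N \<Longrightarrow> (e', l') \<in> N \<Longrightarrow> (e, l) \<noteq> (e', l') \<Longrightarrow>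
        e \<noteq> e' \<and> convex hull e \<inter> convex hull e' \<subseteq> e \<inter> e'"
  shows "drawn_in N S K"
proof -
  have "\<forall>e l. (e, l) \<in> N \<longrightarrow> card e = 2 \<and> convex hull e \<subseteq> S \<and> convex hull e \<inter> K \<subseteq> e"
    using assms(3) by (intro allI impI)
  moreover have "\<forall>e l e' l'. (e, l) \<in> N \<longrightarrow> (e', l') \<in> N \<longrightarrow> (e, l) \<noteq> (e', l') \<longrightarrow>
        e \<noteq> e' \<and> convex hull e \<inter> convex hull e' \<subseteq> e \<inter> e'"
    using assms(4) by (intro allI impI)
  ultimately show ?thesis unfolding drawn_in_def using assms(1,2) by (intro conjI)
qed

lemma drawn_in_edge:
  assumes "drawn_in N S K" "(e, l) \<in> N"
  shows "card e = 2" "convex hull e \<subseteq> S" "convex hull e \<inter> K \<subseteq> e"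
proof -
  have "\<forall>e l. (e, l) \<in> N \<longrightarrow> card e = 2 \<and> convex hull e \<subseteq> S \<and> convex hull e \<inter> K \<subseteq> e"
    using assms(1) unfolding drawn_in_def by (elim conjE)
  then have "card e = 2 \<and> convex hull e \<subseteq> S \<and> convex hull e \<inter> K \<subseteq> e"
    using assms(2) by (elim allE impE)
  then show "card e = 2" "convex hull e \<subseteq> S" "convex hull e \<inter> K \<subseteq> e"
    by simp_all
qed

lemma drawn_in_cross:
  assumes "drawn_in N S K" "(e, l) \<in> N" "(e', l') \<in> N" "(e, l) \<noteq> (e', l')"
  shows "e \<noteq> e' \<and> convex hull e \<inter> convex hull e' \<subseteq> e \<inter> e'"
proof -
  have "\<forall>e l e' l'. (e, l) \<in> N \<longrightarrow> (e', l') \<in> N \<longrightarrow> (e, l) \<noteq> (e', l') \<longrightarrow>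
        e \<noteq> e' \<and> convex hull e \<inter> convex hull e' \<subseteq> e \<inter> e'"
    using assms(1) unfolding drawn_in_def by (elim conjE)
  then show ?thesis using assms(2-4) by (elim allE impE)
qed

lemma infinite_edge:
  fixes e :: "complex set"
  assumes "card e = 2"
  shows "infinite (convex hull e)"
  using assms by (auto simp: card_2_iff segment_convex_hull[symmetric])

text \<open>A common point of edges from the two drawings lies in \<open>K\<close> and
  \<open>K'\<close>, so it is an end of both. The edges differ, since a shared segment would be
  contained in the finite set \<open>K\<close>.\<close>

lemma drawn_in_Un:
  assumes 1: "drawn_in N S K" and 2: "drawn_in N' S' K'" and m: "S \<inter> S' \<subseteq> K \<inter> K'"
  shows "drawn_in (N \<union> N') (S \<union> S') (K \<union> K')"
proof -
  have K: "finite K" "K \<subseteq> S" "K' \<subseteq> S'" "finite K'"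
    using 1 2 by (simp_all add: drawn_in_def)
  note e1 = drawn_in_edge[OF 1] and e2 = drawn_in_edge[OF 2]
  have cross: "convex hull e \<inter> convex hull e' \<subseteq> e \<inter> e'" "e \<noteq> e'"
    if "(e, l) \<in> N" "(e', l') \<in> N'" for e l e' l'
  proof -
    have sub: "convex hull e \<inter> convex hull e' \<subseteq> K \<inter> K'"
      using e1(2)[OF that(1)] e2(2)[OF that(2)] m by blast
    then show "convex hull e \<inter> convex hull e' \<subseteq> e \<inter> e'"
      using e1(3)[OF that(1)] e2(3)[OF that(2)] by blast
    show "e \<noteq> e'"
    proof
      assume "e = e'"
      then have "convex hull e \<subseteq> K" using sub by blast
      then show False using infinite_edge[OF e1(1)[OF that(1)]] K(1) finite_subset by blast
    qed
  qed
  have edge: "card e = 2 \<and> convex hull e \<subseteq> S \<union> S' \<and> convex hull e \<inter> (K \<union> K') \<subseteq> e"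
    if "(e, l) \<in> N \<union> N'" for e l
    using that
  proof
    assume "(e, l) \<in> N"
    from e1[OF this] show ?thesis using m K by blast
  next
    assume "(e, l) \<in> N'"
    from e2[OF this] show ?thesis using m K by blast
  qed
  have edges: "e \<noteq> e' \<and> convex hull e \<inter> convex hull e' \<subseteq> e \<inter> e'"
    if a: "(e, l) \<in> N \<union> N'" "(e', l') \<in> N \<union> N'" and ne: "(e, l) \<noteq> (e', l')" for e l e' l'
  proof -
    consider "(e, l) \<in> N" "(e', l') \<in> N" | "(e, l) \<in> N'" "(e', l') \<in> N'"
      | "(e, l) \<in> N" "(e', l') \<in> N'" | "(e', l') \<in> N" "(e, l) \<in> N'"
      using a by blast
    then show ?thesis
    proof cases
      case 1
      then show ?thesis using drawn_in_cross[OF assms(1)] ne by blast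
    next
      case 2
      then show ?thesis using drawn_in_cross[OF assms(2)] ne by blast
    next
      case 3
      then show ?thesis using cross[OF 3] by blast
    next
      case 4
      then show ?thesis using cross[OF 4] by blast
    qed
  qed
  have "finite (K \<union> K')" "K \<union> K' \<subseteq> S \<union> S'" using K by blast+
  then show ?thesis using edge edges by (rule drawn_inI)
qed

lemma drawn_in_mono:
  assumes "drawn_in N S K" "S \<subseteq> S'" "K' \<subseteq> K"
  shows "drawn_in N S' K'"
proof (rule drawn_inI)
  have "finite K" "K \<subseteq> S" using assms(1) by (simp_all add: drawn_in_def)
  then show "finite K'" "K' \<subseteq> S'"
    using assms(2,3) finite_subset by auto
next
  fix e l assume e: "(e, l) \<in> N"
  show "card e = 2 \<and> convex hull e \<subseteq> S' \<and> convex hull e \<inter> K' \<subseteq> e"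
    using drawn_in_edge[OF assms(1) e] assms(2,3) by auto
qed (rule drawn_in_cross[OF assms(1)])

lemma drawn_in_segment:
  assumes "P \<noteq> Q"
  shows "drawn_in {({P, Q}, l)} (closed_segment P Q) {P, Q}"
proof (rule drawn_inI)
  fix e l' assume "(e, l') \<in> {({P, Q}, l)}"
  then show "card e = 2 \<and> convex hull e \<subseteq> closed_segment P Q \<and> convex hull e \<inter> {P, Q} \<subseteq> e"
    using assms by (simp add: segment_convex_hull)
qed simp_all

fun drawing :: "stacking \<Rightarrow> complex \<Rightarrow> complex \<Rightarrow> complex \<Rightarrow> (complex set \<times> bool) set" where
  "drawing Leaf A B C = {}"
| "drawing (Node k l m T1 T2 T3) A B C =
     (let D = centroid A B C in
      {({A, D}, k)} \<union> {({B, D}, l)} \<union> {({C, D}, m)} \<union>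
      drawing T1 A B D \<union> drawing T2 B C D \<union> drawing T3 C A D)"

lemma finite_drawing: "finite (drawing T A B C)"
  by (induction T arbitrary: A B C) (simp_all add: Let_def)

text \<open>The three spokes and the three faces are glued one by one; each new piece meets the
  earlier ones only in corners or the centroid.\<close>

lemma drawn_in_drawing:
  assumes "nondegenerate A B C"
  shows "drawn_in (drawing T A B C) (region A B C) {A, B, C}"
  using assms
proof (induction T arbitrary: A B C)
  case Leaf
  then show ?case by (simp add: drawn_in_def region_def)
next
  case (Node k l m T1 T2 T3)
  define D where "D = centroid A B C"
  have D: "centroid A B C = D" "centroid B C A = D" "centroid C A B = D"
    "centroid A C B = D" "centroid B A C = D" "centroid C B A = D"
    unfolding D_def by (simp_all add: centroid_def bary_def)
  note nd = Node.prems nondegenerate_rotate[OF Node.prems]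
    nondegenerate_rotate[OF nondegenerate_rotate[OF Node.prems]]
  note nds = nd[THEN nondegenerate_swap]
  note ndc = nd[THEN nondegenerate_centroid, unfolded D]
  note ne = ndc[THEN nondegenerate_corners(2)] ndc[THEN nondegenerate_corners(3)]
  note ss = nd[THEN spokes_meet, unfolded D]
  note sr = nd[THEN spoke_meets_adjacent_region, unfolded D]
    nds[THEN spoke_meets_adjacent_region, unfolded D, unfolded region_flip[of A C] region_flip[of B A]
      region_flip[of C B]]
    nd[THEN spoke_meets_opposite_region, unfolded D]
  note rr = nd[THEN subregions_meet, unfolded D]
    nd(3)[THEN subregions_meet, unfolded D Int_commute[of "region C A D"]]
  have rot: "region B C A = region A B C" "region C A B = region A B C"
    by (simp_all only: region_rotate)
  note sub = spoke_subset[of A B C, unfolded D] spoke_subset[of B C A, unfolded D rot]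
    spoke_subset[of C A B, unfolded D rot] subregion_subset[of A B C, unfolded D]
    subregion_subset[of B C A, unfolded D rot] subregion_subset[of C A B, unfolded D rot]
  have "drawn_in ({({A, D}, k)} \<union> {({B, D}, l)})
      (closed_segment A D \<union> closed_segment B D) ({A, D} \<union> {B, D})"
    using ss ne by (intro drawn_in_Un drawn_in_segment) auto
  then have "drawn_in ({({A, D}, k)} \<union> {({B, D}, l)} \<union> {({C, D}, m)})
      (closed_segment A D \<union> closed_segment B D \<union> closed_segment C D) ({A, D} \<union> {B, D} \<union> {C, D})"
    by (rule drawn_in_Un[OF _ drawn_in_segment]) (use ss ne in auto)
  then have "drawn_in ({({A, D}, k)} \<union> {({B, D}, l)} \<union> {({C, D}, m)} \<union> drawing T1 A B D)
      (closed_segment A D \<union> closed_segment B D \<union> closed_segment C D \<union> region A B D)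
      ({A, D} \<union> {B, D} \<union> {C, D} \<union> {A, B, D})"
    by (rule drawn_in_Un[OF _ Node.IH(1)[OF ndc(1)]]) (simp only: Int_Un_distrib2, intro Un_least,
        (rule order_trans, rule sr rr, simp)+)
  then have "drawn_in ({({A, D}, k)} \<union> {({B, D}, l)} \<union> {({C, D}, m)} \<union> drawing T1 A B D \<union>
       drawing T2 B C D)
      (closed_segment A D \<union> closed_segment B D \<union> closed_segment C D \<union> region A B D \<union> region B C D)
      ({A, D} \<union> {B, D} \<union> {C, D} \<union> {A, B, D} \<union> {B, C, D})"
    by (rule drawn_in_Un[OF _ Node.IH(2)[OF ndc(2)]]) (simp only: Int_Un_distrib2, intro Un_least,
        (rule order_trans, rule sr rr, simp)+)
  then have "drawn_in ({({A, D}, k)} \<union> {({B, D}, l)} \<union> {({C, D}, m)} \<union> drawing T1 A B D \<union>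
       drawing T2 B C D \<union> drawing T3 C A D)
      (closed_segment A D \<union> closed_segment B D \<union> closed_segment C D \<union> region A B D \<union> region B C D
       \<union> region C A D)
      ({A, D} \<union> {B, D} \<union> {C, D} \<union> {A, B, D} \<union> {B, C, D} \<union> {C, A, D})"
    by (rule drawn_in_Un[OF _ Node.IH(3)[OF ndc(3)]]) (simp only: Int_Un_distrib2, intro Un_least,
        (rule order_trans, rule sr rr, simp)+)
  then have "drawn_in (drawing (Node k l m T1 T2 T3) A B C)
      (closed_segment A D \<union> closed_segment B D \<union> closed_segment C D \<union> region A B D \<union> region B C D
       \<union> region C A D)
      ({A, D} \<union> {B, D} \<union> {C, D} \<union> {A, B, D} \<union> {B, C, D} \<union> {C, A, D})"
    by (simp add: Let_def D)
  then show ?case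
  proof (rule drawn_in_mono)
    show "closed_segment A D \<union> closed_segment B D \<union> closed_segment C D \<union> region A B D \<union>
        region B C D \<union> region C A D \<subseteq> region A B C"
      by (intro Un_least sub)
  qed simp
qed

section \<open>A planar graph of inversion diameter at least 6\<close>

text \<open>The vector at the centroid is the witness for the stacked vertex.\<close>

lemma sat_of_drawing:
  assumes "\<And>u v l. ({u, v}, l) \<in> drawing T A B C \<Longrightarrow> dot (f u) (f v) = l"
  shows "sat T (f A) (f B) (f C)"
  using assms
proof (induction T arbitrary: A B C)
  case (Node k l m T1 T2 T3)
  define D where "D = centroid A B C"
  have mem: "dot (f u) (f v) = l'"
    if "({u, v}, l') \<in> {({A, D}, k)} \<union> {({B, D}, l)} \<union> {({C, D}, m)} \<union>
      drawing T1 A B D \<union> drawing T2 B C D \<union> drawing T3 C A D" for u v l'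
    using Node.prems[of u v l'] that by (simp only: drawing.simps Let_def D_def)
  have "dot (f A) (f D) = k" "dot (f B) (f D) = l" "dot (f C) (f D) = m"
    by (rule mem; simp)+
  moreover have "sat T1 (f A) (f B) (f D)" "sat T2 (f B) (f C) (f D)" "sat T3 (f C) (f A) (f D)"
    by (rule Node.IH, rule mem, simp)+
  ultimately show ?case by auto
qed simp

lemma nondegenerate_example: "nondegenerate 0 1 \<i>"
  by (auto simp: nondegenerate_def bary_def complex_eq_iff)

theorem mainTheorem4:
  "\<exists>(V :: nat set) (E :: nat set set). planar_graph V E \<and> inversion_diameter V E \<ge> 6"
proof -
  obtain T where T: "\<And>a b c. \<not> sat T a b c" using unsatisfiable_stacking by blast
  define N where "N = drawing T 0 1 \<i>"
  have dr: "drawn_in N (region 0 1 \<i>) {0, 1, \<i>}"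
    unfolding N_def by (rule drawn_in_drawing[OF nondegenerate_example])
  note edge = drawn_in_edge[OF dr]
  define V0 where "V0 = \<Union> (fst ` N)"
  have card2: "card e = 2" if "e \<in> fst ` N" for e
    using that edge(1) by auto
  have "finite e" if "e \<in> fst ` N" for e
    using card2[OF that] card.infinite[of e] by fastforce
  then have "finite V0"
    unfolding V0_def N_def by (intro finite_Union finite_imageI finite_drawing) blast
  \<comment> \<open>Natural numbers rename the points; the inverse \<open>p\<close> of the renaming
    is the placement of the vertices.\<close>
  then obtain h :: "complex \<Rightarrow> nat" where h: "inj_on h V0"
    using finite_imp_inj_to_nat_seg by metis
  define p where "p = inv_into V0 h"
  have ph: "p (h x) = x" if "x \<in> V0" for x
    using that h by (simp add: p_def)
  have sub: "e \<subseteq> V0" if "e \<in> fst ` N" for e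
    using that by (auto simp: V0_def)
  have pe: "p ` h ` e = e" if "e \<subseteq> V0" for e
    using that ph by (force simp: image_image)
  define V E where "V = h ` V0" and "E = (`) h ` fst ` N"
  have E_edge: "\<exists>e0 l. (e0, l) \<in> N \<and> e = h ` e0" if "e \<in> E" for e
    using that unfolding E_def by auto
  have cross: "e \<noteq> e' \<and> convex hull e \<inter> convex hull e' \<subseteq> e \<inter> e'"
    if "(e, l) \<in> N" "(e', l') \<in> N" "(e, l) \<noteq> (e', l')" for e l e' l'
    using drawn_in_cross[OF dr that] .
  have planar: "planar_graph V E"
  proof (rule planar_graph_straight_line)
    show "finite V" using \<open>finite V0\<close> by (simp add: V_def)
    show "inj_on p V" unfolding p_def V_def by (rule inj_on_inv_into) simp
    show "\<forall>e\<in>E. e \<subseteq> V \<and> card e = 2"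
    proof
      fix e assume "e \<in> E"
      then obtain e0 where e0: "e0 \<in> fst ` N" "e = h ` e0" unfolding E_def by blast
      have "card e = card e0" unfolding e0(2)
        by (rule card_image) (rule inj_on_subset[OF h sub[OF e0(1)]])
      then show "e \<subseteq> V \<and> card e = 2"
        using e0 card2[OF e0(1)] sub[OF e0(1)] by (auto simp: V_def)
    qed
    \<comment> \<open>Every point of \<open>V0\<close> is an end of some edge, so this follows from
      the crossing condition.\<close>
    have vert: "x \<in> e" if e: "(e, l) \<in> N" and x: "x \<in> V0" "x \<in> convex hull e" for e l x
    proof -
      obtain e' l' where e': "(e', l') \<in> N" "x \<in> e'" using x(1) unfolding V0_def by auto
      have "x \<in> convex hull e'" using e'(2) by (rule hull_inc)
      then show ?thesis using cross[OF e e'(1)] x(2) e'(2) by blast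
    qed
    show "\<forall>e\<in>E. convex hull (p ` e) \<inter> p ` V \<subseteq> p ` e"
    proof
      fix e assume "e \<in> E"
      then obtain e0 l where e0: "(e0, l) \<in> N" "e = h ` e0" using E_edge by blast
      have "e0 \<subseteq> V0" using sub e0(1) by force
      then show "convex hull (p ` e) \<inter> p ` V \<subseteq> p ` e"
        using vert[OF e0(1)] unfolding e0(2) V_def by (auto simp: pe)
    qed
    show "\<forall>e\<in>E. \<forall>e'\<in>E. e \<noteq> e' \<longrightarrow> convex hull (p ` e) \<inter> convex hull (p ` e') \<subseteq> p ` (e \<inter> e')"
    proof (intro ballI impI)
      fix e e' assume "e \<in> E" "e' \<in> E" and ne: "e \<noteq> e'"
      then obtain e0 l e1 l' where e0: "(e0, l) \<in> N" "e = h ` e0" and e1: "(e1, l') \<in> N" "e' = h ` e1"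
        using E_edge by meson
      have s: "e0 \<subseteq> V0" "e1 \<subseteq> V0" using sub e0(1) e1(1) by force+
      have "h ` e0 \<inter> h ` e1 = h ` (e0 \<inter> e1)"
        using h s by (simp add: inj_on_image_Int)
      moreover have "p ` h ` (e0 \<inter> e1) = e0 \<inter> e1" using s by (intro pe) blast
      moreover have "convex hull e0 \<inter> convex hull e1 \<subseteq> e0 \<inter> e1"
        using cross[OF e0(1) e1(1)] ne e0(2) e1(2) by blast
      ultimately show "convex hull (p ` e) \<inter> convex hull (p ` e') \<subseteq> p ` (e \<inter> e')"
        unfolding e0(2) e1(2) by (simp only: pe[OF s(1)] pe[OF s(2)])
    qed
  qed
  have "\<not> inversion_diameter V E \<le> 5"
  proof
    assume diam: "inversion_diameter V E \<le> 5"
    define F where "F = (`) h ` {e. (e, True) \<in> N}"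
    have "simple_graph V E" using planar by (simp add: planar_graph_def)
    then obtain f where f: "\<And>u v. {u, v} \<in> E \<Longrightarrow> dot (f u) (f v) = ({u, v} \<in> F)"
      using vectors_of_inversion_diameter[OF _ diam] by blast
    have "dot ((f \<circ> h) u) ((f \<circ> h) v) = l" if uv: "({u, v}, l) \<in> N" for u v l
    proof -
      have uv0: "{u, v} \<subseteq> V0" using sub uv by force
      have "{u, v} \<in> fst ` N" using uv by force
      then have "h ` {u, v} \<in> E" unfolding E_def by (rule imageI)
      then have "dot (f (h u)) (f (h v)) = (h ` {u, v} \<in> F)"
        using f[of "h u" "h v"] by simp
      also have "\<dots> = l"
      proof
        assume l
        then have "{u, v} \<in> {e. (e, True) \<in> N}" using uv by simp
        then show "h ` {u, v} \<in> F" unfolding F_def by (rule imageI)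
      next
        assume "h ` {u, v} \<in> F"
        then obtain e where e: "h ` {u, v} = h ` e" "(e, True) \<in> N" unfolding F_def by blast
        have "e \<subseteq> V0" using sub e(2) by force
        then have "e = {u, v}" using inj_on_image_eq_iff[OF h uv0] e(1) by blast
        \<comment> \<open>No edge of the drawing carries two labels.\<close>
        then show l using cross[OF e(2) uv] by blast
      qed
      finally show ?thesis by simp
    qed
    then have "sat T ((f \<circ> h) 0) ((f \<circ> h) 1) ((f \<circ> h) \<i>)"
      by (intro sat_of_drawing) (simp add: N_def)
    then show False using T by blast
  qed
  then have "6 \<le> inversion_diameter V E" by simp
  with planar show ?thesis by blast
qed

end
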